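(* Let $\mathbb{K}\in\{\mathbb{R},\mathbb{C}\}$, let $\mathcal{X}=\mathcal{D}(\Omega_{\mathcal X},\mathbb{K}^{n_{\mathcal X}})$ and $\mathcal{Y}=\mathcal{D}(\Omega_{\mathcal Y},\mathbb{K}^{n_{\mathcal Y}})$ be spaces of test functions on domains $\Omega_{\mathcal X}\subseteq\mathbb{R}^{d_{\mathcal X}}$ and $\Omega_{\mathcal Y}\subseteq\mathbb{R}^{d_{\mathcal Y}}$, let $G$ be a Lie group, let $\mathscr{P}_{\mathcal X}:G\to \mathrm{GL}(\mathcal{X})$ be a group representation of $G$ on $\mathcal{X}$, and let $\mathscr{A}:\mathcal{X}\to\mathcal{Y}$ be a continuous linear operator (the measurement operator). Consider the relation $$\mathscr{P}_{\mathcal Y}[g]\,\mathscr{A}x=\mathscr{A}\,\mathscr{P}_{\mathcal X}[g]\,x\qquad\text{for all } x\in\mathcal{X}. \tag{E}$$ Then the following statements are equivalent. (i) For every $g\in G$, the mapping $\mathscr{P}_{\mathcal Y}[g]:\mathrm{Rg}(\mathscr{A})\to\mathrm{Rg}(\mathscr{A})$ given by (E), i.e. $\mathscr{A}x\mapsto\mathscr{A}\mathscr{P}_{\mathcal X}[g]x$, is well-defined. (ii) Relation (E) defines a group representation $\mathscr{P}_{\mathcal Y}$ of $G$ by mappings $\mathrm{Rg}(\mathscr{A})\to\mathrm{Rg}(\mathscr{A})$. (iii) $\mathrm{Ker}(\mathscr{A}\,\mathscr{P}_{\mathcal X}[g])=\mathrm{Ker}(\mathscr{A})$ for all $g\in 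G$.
   Context: $\mathcal{D}(\Omega,\mathbb{K}^n)$ denotes the space of $\mathbb{K}^n$-valued test functions on $\Omega$. A (group) representation of $G$ on a vector space $\mathcal{V}$ is a group homomorphism $\mathscr{P}:G\to\mathrm{GL}(\mathcal{V})$; in particular each $\mathscr{P}[g]$ is linear and invertible, $\mathscr{P}[e]=\mathrm{Id}$ and $\mathscr{P}[gh]=\mathscr{P}[g]\mathscr{P}[h]$. $\mathrm{Rg}(\mathscr{A})=\{\mathscr{A}x\mid x\in\mathcal{X}\}$ is the range and $\mathrm{Ker}$ denotes the kernel (null space) of a linear operator. In (ii), a representation by mappings $\mathrm{Rg}(\mathscr{A})\to\mathrm{Rg}(\mathscr{A})$ means a representation on the vector space $\mathrm{Rg}(\mathscr{A})\subseteq\mathcal{Y}$. *)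

theory Defs
  imports
    "HOL-Analysis.Analysis"
    "HOL-Algebra.Bij"
    "HOL-Library.Function_Algebras"
begin

section \<open>The scalar field\<close>

text \<open>
  The scalar field is the field of real numbers or that of complex numbers. The assumption
  leaves only these two, up to isomorphism: the norm is multiplicative and extends the
  absolute value of the reals, so it is the usual one in both cases.
\<close>

class real_or_complex = real_normed_field +
  assumes real_or_complex:
    "(\<forall>z. \<exists>a. z = a *\<^sub>R 1) \<or> (\<exists>i. i * i = - 1 \<and> (\<forall>z. \<exists>a b. z = a *\<^sub>R 1 + b *\<^sub>R i))"

instance real :: real_or_complex
  by standard simp

instance complex :: real_or_complex
proof
  have "z = Re z *\<^sub>R 1 + Im z *\<^sub>R \<i>" for z
    by (simp add: complex_eq_iff)
  then have "\<i> * \<i> = - 1 \<and> (\<forall>z. \<exists>a b. z = a *\<^sub>R 1 + b *\<^sub>R \<i>)"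
    using i_squared by blast
  then show "(\<forall>z::complex. \<exists>a. z = a *\<^sub>R 1) \<or>
      (\<exists>i::complex. i * i = - 1 \<and> (\<forall>z. \<exists>a b. z = a *\<^sub>R 1 + b *\<^sub>R i))"
    by blast
qed


section \<open>Smooth functions\<close>

primrec iter_deriv ::
  "'a list \<Rightarrow> ('a::euclidean_space \<Rightarrow> 'b::real_normed_vector) \<Rightarrow> 'a \<Rightarrow> 'b" where
  "iter_deriv [] f = f"
| "iter_deriv (v # vs) f = (\<lambda>x. frechet_derivative (iter_deriv vs f) (at x) v)"

text \<open>
  On an open set: all iterated partial derivatives exist and are differentiable, hence also
  continuous.
\<close>

definition smooth_open :: "'a::euclidean_space set \<Rightarrow> ('a \<Rightarrow> 'b::real_normed_vector) \<Rightarrow> bool" where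
  "smooth_open U f \<longleftrightarrow> open U \<and> (\<forall>vs \<in> lists Basis. iter_deriv vs f differentiable_on U)"

text \<open>On an arbitrary set: locally the restriction of a smooth function on an open set.\<close>

definition smooth_on :: "'a::euclidean_space set \<Rightarrow> ('a \<Rightarrow> 'b::real_normed_vector) \<Rightarrow> bool" where
  "smooth_on S f \<longleftrightarrow> (\<forall>x \<in> S. \<exists>U g. x \<in> U \<and> smooth_open U g \<and> (\<forall>y \<in> S \<inter> U. f y = g y))"


section \<open>Lie groups\<close>

text \<open>
  Manifolds are modelled on a linear subspace \<open>E\<close> of a Euclidean space, so that the dimension,
  which is \<open>dim E\<close>, may be \<open>0\<close>. An atlas consists of pairs of a chart domain and a coordinate
  map; only the values of the coordinate map on the chart domain matter. The atlas need not be
  maximal.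
\<close>

definition smooth_atlas ::
  "'p topology \<Rightarrow> 'e::euclidean_space set \<Rightarrow> ('p set \<times> ('p \<Rightarrow> 'e)) set \<Rightarrow> bool" where
  "smooth_atlas T E \<A> \<longleftrightarrow>
     (\<Union>(U, \<phi>) \<in> \<A>. U) = topspace T \<and>
     (\<forall>(U, \<phi>) \<in> \<A>. openin T U \<and> openin (top_of_set E) (\<phi> ` U) \<and>
        homeomorphic_map (subtopology T U) (top_of_set (\<phi> ` U)) \<phi>) \<and>
     (\<forall>(U, \<phi>) \<in> \<A>. \<forall>(V, \<psi>) \<in> \<A>. smooth_on (\<phi> ` (U \<inter> V)) (\<psi> \<circ> inv_into U \<phi>))"

definition smooth_manifold ::
  "'p topology \<Rightarrow> 'e::euclidean_space set \<Rightarrow> ('p set \<times> ('p \<Rightarrow> 'e)) set \<Rightarrow> bool" where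
  "smooth_manifold T E \<A> \<longleftrightarrow>
     subspace E \<and> Hausdorff_space T \<and> second_countable T \<and> smooth_atlas T E \<A>"

definition smooth_map ::
  "'p topology \<Rightarrow> ('p set \<times> ('p \<Rightarrow> 'e::euclidean_space)) set \<Rightarrow>
   'q topology \<Rightarrow> ('q set \<times> ('q \<Rightarrow> 'f::euclidean_space)) set \<Rightarrow> ('p \<Rightarrow> 'q) \<Rightarrow> bool" where
  "smooth_map T \<A> T' \<B> F \<longleftrightarrow>
     continuous_map T T' F \<and>
     (\<forall>(U, \<phi>) \<in> \<A>. \<forall>(V, \<psi>) \<in> \<B>. smooth_on (\<phi> ` (U \<inter> F -` V)) (\<psi> \<circ> F \<circ> inv_into U \<phi>))"

definition prod_atlas ::
  "('p set \<times> ('p \<Rightarrow> 'e)) set \<Rightarrow> ('q set \<times> ('q \<Rightarrow> 'f)) set \<Rightarrow>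
   (('p \<times> 'q) set \<times> ('p \<times> 'q \<Rightarrow> 'e \<times> 'f)) set" where
  "prod_atlas \<A> \<B> = (\<lambda>((U, \<phi>), (V, \<psi>)). (U \<times> V, map_prod \<phi> \<psi>)) ` (\<A> \<times> \<B>)"

locale lie_group = group G for G (structure) +
  fixes T :: "'a topology"
    and E :: "'e::euclidean_space set"
    and \<A> :: "('a set \<times> ('a \<Rightarrow> 'e)) set"
  assumes topspace_eq_carrier: "topspace T = carrier G"
    and manifold: "smooth_manifold T E \<A>"
    and mult_smooth: "smooth_map (prod_topology T T) (prod_atlas \<A> \<A>) T \<A> (\<lambda>(g, h). g \<otimes> h)"
    and inv_smooth: "smooth_map T \<A> T \<A> (\<lambda>g. inv g)"


section \<open>Linear maps and representations on spaces of vector-valued functions\<close>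

text \<open>Addition and the zero of the function spaces are the pointwise ones.\<close>

definition fun_scale :: "'k::field \<Rightarrow> ('a \<Rightarrow> 'k ^ 'n) \<Rightarrow> 'a \<Rightarrow> 'k ^ 'n" where
  "fun_scale c f = (\<lambda>x. c *s f x)"

lemma vector_space_fun_scale: "vector_space fun_scale"
  by unfold_locales (auto simp: fun_scale_def vec_eq_iff algebra_simps)

definition linear_op_on ::
  "('a \<Rightarrow> 'k::field ^ 'n) set \<Rightarrow> (('a \<Rightarrow> 'k ^ 'n) \<Rightarrow> ('b \<Rightarrow> 'k ^ 'm)) \<Rightarrow> bool" where
  "linear_op_on V L \<longleftrightarrow>
     (\<forall>f \<in> V. \<forall>g \<in> V. L (f + g) = L f + L g) \<and>
     (\<forall>c. \<forall>f \<in> V. L (fun_scale c f) = fun_scale c (L f))"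

definition ker_on :: "'a set \<Rightarrow> ('a \<Rightarrow> 'b::zero) \<Rightarrow> 'a set" where
  "ker_on V L = {f \<in> V. L f = 0}"

definition GL :: "('a \<Rightarrow> 'k::field ^ 'n) set \<Rightarrow> (('a \<Rightarrow> 'k ^ 'n) \<Rightarrow> ('a \<Rightarrow> 'k ^ 'n)) monoid" where
  "GL V = (BijGroup V)\<lparr>carrier := {L \<in> Bij V. linear_op_on V L}\<rparr>"

definition representation ::
  "('g, 'r) monoid_scheme \<Rightarrow> ('a \<Rightarrow> 'k::field ^ 'n) set \<Rightarrow>
   ('g \<Rightarrow> ('a \<Rightarrow> 'k ^ 'n) \<Rightarrow> ('a \<Rightarrow> 'k ^ 'n)) \<Rightarrow> bool" where
  "representation G V \<rho> \<longleftrightarrow> \<rho> \<in> hom G (GL V)"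

lemma group_GL:
  fixes V :: "('a \<Rightarrow> 'k::field ^ 'n) set"
  assumes V: "module.subspace fun_scale V"
  shows "group (GL V)"
proof -
  interpret vector_space "fun_scale :: 'k \<Rightarrow> ('a \<Rightarrow> 'k ^ 'n) \<Rightarrow> _"
    by (rule vector_space_fun_scale)
  interpret B: group "BijGroup V" by (rule group_BijGroup)
  have add: "f + g \<in> V" if "f \<in> V" "g \<in> V" for f g using V that by (rule subspace_add)
  have scale: "fun_scale c f \<in> V" if "f \<in> V" for c f using V that by (rule subspace_scale)
  have "subgroup {L \<in> Bij V. linear_op_on V L} (BijGroup V)"
  proof (rule B.subgroupI)
    show "{L \<in> Bij V. linear_op_on V L} \<subseteq> carrier (BijGroup V)"
      by (auto simp: BijGroup_def)
    show "{L \<in> Bij V. linear_op_on V L} \<noteq> {}"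
      using id_Bij[of V] by (auto simp: linear_op_on_def add scale intro!: exI[of _ "\<lambda>x\<in>V. x"])
  next
    fix L assume "L \<in> {L \<in> Bij V. linear_op_on V L}"
    then have L: "L \<in> Bij V" and lin: "linear_op_on V L" by auto
    let ?M = "restrict (inv_into V L) V"
    have bij: "bij_betw L V V" using L by (simp add: Bij_def)
    have M: "?M \<in> Bij V" using L by (rule restrict_inv_into_Bij)
    have L_inv: "L (inv_into V L y) = y" "inv_into V L y \<in> V" if "y \<in> V" for y
      using that bij by (auto simp: bij_betw_def f_inv_into_f inv_into_into)
    have inv_L: "inv_into V L (L x) = x" if "x \<in> V" for x
      using that bij by (simp add: bij_betw_def)
    have "inv_into V L (f + g) = inv_into V L f + inv_into V L g" if "f \<in> V" "g \<in> V" for f g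
    proof -
      have "f + g = L (inv_into V L f + inv_into V L g)"
        using lin L_inv that by (simp add: linear_op_on_def)
      then show ?thesis using inv_L add L_inv that by metis
    qed
    moreover have "inv_into V L (fun_scale c f) = fun_scale c (inv_into V L f)" if "f \<in> V" for c f
    proof -
      have "fun_scale c f = L (fun_scale c (inv_into V L f))"
        using lin L_inv that by (simp add: linear_op_on_def)
      then show ?thesis using inv_L scale L_inv that by metis
    qed
    ultimately have "linear_op_on V ?M" by (simp add: linear_op_on_def add scale)
    then show "inv\<^bsub>BijGroup V\<^esub> L \<in> {L \<in> Bij V. linear_op_on V L}"
      using M L by (simp add: inv_BijGroup)
  next
    fix L M assume "L \<in> {L \<in> Bij V. linear_op_on V L}" "M \<in> {L \<in> Bij V. linear_op_on V L}"
    then have L: "L \<in> Bij V" "linear_op_on V L" and M: "M \<in> Bij V" "linear_op_on V M" by auto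
    have "M f \<in> V" if "f \<in> V" for f using M that by (auto dest: Bij_imp_funcset)
    then have "linear_op_on V (compose V L M)"
      using L M by (simp add: linear_op_on_def compose_def add scale)
    then show "L \<otimes>\<^bsub>BijGroup V\<^esub> M \<in> {L \<in> Bij V. linear_op_on V L}"
      using L M by (simp add: BijGroup_def compose_Bij)
  qed
  then show ?thesis unfolding GL_def by (rule B.subgroup_imp_group)
qed


section \<open>Test functions\<close>

text \<open>
  A test function on \<open>\<Omega>\<close> is identified with its extension by zero to the whole space.
\<close>

definition supp :: "('a::topological_space \<Rightarrow> 'b::zero) \<Rightarrow> 'a set" where
  "supp f = closure {x. f x \<noteq> 0}"

definition test_functions_in ::
  "(real ^ 'd) set \<Rightarrow> (real ^ 'd \<Rightarrow> 'k::real_or_complex ^ 'n) set" where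
  "test_functions_in K = {f. smooth_open UNIV f \<and> supp f \<subseteq> K}"

definition test_functions ::
  "(real ^ 'd) set \<Rightarrow> (real ^ 'd \<Rightarrow> 'k::real_or_complex ^ 'n) set" where
  "test_functions \<Omega> = {f. smooth_open UNIV f \<and> compact (supp f) \<and> supp f \<subseteq> \<Omega>}"

text \<open>
  The usual topology of the space of test functions. For compact \<open>K\<close>, the space of test functions
  with support in \<open>K\<close> has the Frechet topology given by the seminorms
  \<open>max {|D\<^sup>\<alpha> f x| | x, |\<alpha>| \<le> N}\<close>. The topology of the space of test functions on \<open>\<Omega>\<close> is the
  inductive limit in the category of locally convex spaces: a base of neighbourhoods of \<open>0\<close> is
  given by the nonempty absolutely convex sets whose intersection with each of these spaces is
  open.
\<close>

definition open_test_functions_in ::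
  "(real ^ 'd) set \<Rightarrow> (real ^ 'd \<Rightarrow> 'k::real_or_complex ^ 'n) set \<Rightarrow> bool" where
  "open_test_functions_in K W \<longleftrightarrow>
     W \<subseteq> test_functions_in K \<and>
     (\<forall>f \<in> W. \<exists>N. \<exists>\<epsilon>>0. \<forall>g \<in> test_functions_in K.
        (\<forall>vs \<in> lists Basis. length vs \<le> N \<longrightarrow> (\<forall>x. norm (iter_deriv vs (g - f) x) < \<epsilon>))
        \<longrightarrow> g \<in> W)"

definition absolutely_convex :: "('a \<Rightarrow> 'k::real_or_complex ^ 'n) set \<Rightarrow> bool" where
  "absolutely_convex W \<longleftrightarrow>
     (\<forall>f \<in> W. \<forall>g \<in> W. \<forall>a b. norm a + norm b \<le> 1 \<longrightarrow> fun_scale a f + fun_scale b g \<in> W)"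

definition test_nbhds ::
  "(real ^ 'd) set \<Rightarrow> (real ^ 'd \<Rightarrow> 'k::real_or_complex ^ 'n) set set" where
  "test_nbhds \<Omega> = {W. W \<noteq> {} \<and> W \<subseteq> test_functions \<Omega> \<and> absolutely_convex W \<and>
     (\<forall>K. compact K \<and> K \<subseteq> \<Omega> \<longrightarrow> open_test_functions_in K (W \<inter> test_functions_in K))}"

definition test_topology ::
  "(real ^ 'd) set \<Rightarrow> (real ^ 'd \<Rightarrow> 'k::real_or_complex ^ 'n) topology" where
  "test_topology \<Omega> = topology (\<lambda>U. U \<subseteq> test_functions \<Omega> \<and>
     (\<forall>f \<in> U. \<exists>W \<in> test_nbhds \<Omega>. (\<lambda>w. f + w) ` W \<subseteq> U))"


lemma bounded_linear_scale_vec: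
  "bounded_linear (\<lambda>y :: 'k::real_or_complex ^ 'n. c *s y)"
proof (rule bounded_linear_intro[where K = "norm c"])
  fix x y :: "'k ^ 'n" and r :: real
  show "c *s (x + y) = c *s x + c *s y" by (rule vector_add_ldistrib)
  show "c *s (r *\<^sub>R x) = r *\<^sub>R (c *s x)" by (simp add: vec_eq_iff)
  show "norm (c *s x) \<le> norm x * norm c"
    by (simp add: norm_vec_def norm_mult L2_set_right_distrib mult.commute)
qed

lemma has_derivative_lincomb:
  fixes f g :: "'a::euclidean_space \<Rightarrow> 'k::real_or_complex ^ 'n"
  assumes "(f has_derivative f') (at x)" "(g has_derivative g') (at x)"
  shows "((fun_scale a f + fun_scale b g) has_derivative (fun_scale a f' + fun_scale b g')) (at x)"
  using has_derivative_add[OF bounded_linear.has_derivative[OF bounded_linear_scale_vec assms(1)]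
      bounded_linear.has_derivative[OF bounded_linear_scale_vec assms(2)]]
  by (simp add: fun_scale_def plus_fun_def)

lemma iter_deriv_lincomb:
  fixes f g :: "'a::euclidean_space \<Rightarrow> 'k::real_or_complex ^ 'n"
  assumes "smooth_open UNIV f" "smooth_open UNIV g" "vs \<in> lists Basis"
  shows "iter_deriv vs (fun_scale a f + fun_scale b g) =
    fun_scale a (iter_deriv vs f) + fun_scale b (iter_deriv vs g)"
  using assms(3)
proof (induction vs)
  case (Cons v vs)
  have "(iter_deriv vs f has_derivative frechet_derivative (iter_deriv vs f) (at x)) (at x)"
    "(iter_deriv vs g has_derivative frechet_derivative (iter_deriv vs g) (at x)) (at x)" for x
    using assms(1,2) Cons.hyps
    by (auto simp: smooth_open_def differentiable_on_def frechet_derivative_works)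
  from frechet_derivative_at[OF has_derivative_lincomb[OF this], symmetric]
  have "frechet_derivative (fun_scale a (iter_deriv vs f) + fun_scale b (iter_deriv vs g)) (at x) =
      fun_scale a (frechet_derivative (iter_deriv vs f) (at x)) +
      fun_scale b (frechet_derivative (iter_deriv vs g) (at x))" for x .
  then show ?case by (simp only: iter_deriv.simps Cons.IH) (simp add: fun_scale_def plus_fun_def)
qed simp

lemma smooth_open_lincomb:
  fixes f g :: "'a::euclidean_space \<Rightarrow> 'k::real_or_complex ^ 'n"
  assumes "smooth_open UNIV f" "smooth_open UNIV g"
  shows "smooth_open UNIV (fun_scale a f + fun_scale b g)"
  using assms unfolding smooth_open_def differentiable_on_def differentiable_def
  by (simp add: iter_deriv_lincomb[OF assms]) (meson has_derivative_lincomb)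

lemma smooth_open_0: "smooth_open UNIV (0 :: 'a::euclidean_space \<Rightarrow> 'b::real_normed_vector)"
proof -
  have "iter_deriv vs (0 :: 'a \<Rightarrow> 'b) = 0" for vs
    by (induction vs) (auto simp: zero_fun_def)
  then show ?thesis by (simp add: smooth_open_def zero_fun_def)
qed

lemma test_functions_lincomb:
  assumes "f \<in> test_functions \<Omega>" "g \<in> test_functions \<Omega>"
  shows "fun_scale a f + fun_scale b g \<in> test_functions \<Omega>"
proof -
  have "supp (fun_scale a f + fun_scale b g) \<subseteq> supp f \<union> supp g"
    unfolding supp_def closure_Un[symmetric] by (rule closure_mono) (auto simp: fun_scale_def)
  moreover have "compact (supp f \<union> supp g)" "supp f \<union> supp g \<subseteq> \<Omega>"
    using assms by (auto simp: test_functions_def)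
  ultimately have "compact (supp (fun_scale a f + fun_scale b g))"
    and "supp (fun_scale a f + fun_scale b g) \<subseteq> \<Omega>"
    by (metis closed_closure compact_Int_closed inf.absorb2 supp_def, metis subset_trans)
  then show ?thesis using assms by (simp add: test_functions_def smooth_open_lincomb)
qed

lemma zero_in_test_functions: "0 \<in> test_functions \<Omega>"
  using smooth_open_0 by (simp add: test_functions_def supp_def)

lemma test_functions_add:
  assumes "f \<in> test_functions \<Omega>" "g \<in> test_functions \<Omega>"
  shows "f + g \<in> test_functions \<Omega>"
  using test_functions_lincomb[OF assms, of 1 1] by (simp add: fun_scale_def)

lemma subspace_test_functions:
  "module.subspace fun_scale (test_functions \<Omega> :: (real ^ 'd \<Rightarrow> 'k::real_or_complex ^ 'n) set)"
proof -
  interpret vector_space "fun_scale :: 'k \<Rightarrow> (real ^ 'd \<Rightarrow> 'k ^ 'n) \<Rightarrow> _"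
    by (rule vector_space_fun_scale)
  show ?thesis
  proof (rule subspaceI)
    fix c :: 'k and f :: "real ^ 'd \<Rightarrow> 'k ^ 'n" assume "f \<in> test_functions \<Omega>"
    from test_functions_lincomb[OF this this, of c 0]
    show "fun_scale c f \<in> test_functions \<Omega>" by (simp add: fun_scale_def plus_fun_def)
  qed (simp_all add: zero_in_test_functions test_functions_add)
qed

lemma zero_in_test_nbhds:
  assumes "W \<in> test_nbhds \<Omega>"
  shows "0 \<in> W"
proof -
  obtain f where f: "f \<in> W" using assms by (auto simp: test_nbhds_def)
  then have "fun_scale 0 f + fun_scale 0 f \<in> W"
    using assms unfolding test_nbhds_def absolutely_convex_def
    by (metis (mono_tags, lifting) add_0 mem_Collect_eq norm_zero zero_le_one)
  moreover have "fun_scale 0 f + fun_scale 0 f = 0"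
    by (simp add: fun_scale_def fun_eq_iff)
  ultimately show ?thesis by simp
qed

lemma open_test_functions_in_Int:
  assumes "open_test_functions_in K V" "open_test_functions_in K W"
  shows "open_test_functions_in K (V \<inter> W)"
  unfolding open_test_functions_in_def
proof (intro conjI ballI)
  show "V \<inter> W \<subseteq> test_functions_in K" using assms by (auto simp: open_test_functions_in_def)
next
  fix f assume f: "f \<in> V \<inter> W"
  obtain M \<delta> where M: "\<delta> > 0" "\<forall>g \<in> test_functions_in K.
      (\<forall>vs \<in> lists Basis. length vs \<le> M \<longrightarrow> (\<forall>x. norm (iter_deriv vs (g - f) x) < \<delta>)) \<longrightarrow> g \<in> V"
    using assms(1) f unfolding open_test_functions_in_def by blast
  obtain N \<epsilon> where N: "\<epsilon> > 0" "\<forall>g \<in> test_functions_in K.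
      (\<forall>vs \<in> lists Basis. length vs \<le> N \<longrightarrow> (\<forall>x. norm (iter_deriv vs (g - f) x) < \<epsilon>)) \<longrightarrow> g \<in> W"
    using assms(2) f unfolding open_test_functions_in_def by blast
  show "\<exists>N. \<exists>\<epsilon>>0. \<forall>g \<in> test_functions_in K.
      (\<forall>vs \<in> lists Basis. length vs \<le> N \<longrightarrow> (\<forall>x. norm (iter_deriv vs (g - f) x) < \<epsilon>)) \<longrightarrow>
      g \<in> V \<inter> W"
    using M N by (intro exI[of _ "max M N"] exI[of _ "min \<delta> \<epsilon>"]) auto
qed

lemma test_nbhds_Int:
  assumes "V \<in> test_nbhds \<Omega>" "W \<in> test_nbhds \<Omega>"
  shows "V \<inter> W \<in> test_nbhds \<Omega>"
proof -
  have "0 \<in> V \<inter> W" using assms zero_in_test_nbhds by blast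
  moreover have "V \<inter> W \<inter> test_functions_in K =
      (V \<inter> test_functions_in K) \<inter> (W \<inter> test_functions_in K)" for K by blast
  ultimately show ?thesis using assms
    by (auto simp: test_nbhds_def absolutely_convex_def intro: open_test_functions_in_Int)
qed

lemma test_functions_in_test_nbhds:
  "(test_functions \<Omega> :: (real ^ 'd \<Rightarrow> 'k::real_or_complex ^ 'n) set) \<in> test_nbhds \<Omega>"
proof -
  have "(test_functions_in K :: (real ^ 'd \<Rightarrow> 'k ^ 'n) set) \<subseteq> test_functions \<Omega>"
    if "compact K" "K \<subseteq> \<Omega>" for K
  proof
    fix f :: "real ^ 'd \<Rightarrow> 'k ^ 'n" assume f: "f \<in> test_functions_in K"
    then have "compact (supp f)"
      using that by (metis (mono_tags, lifting) closed_closure compact_Int_closed inf.absorb2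
          mem_Collect_eq supp_def test_functions_in_def)
    then show "f \<in> test_functions \<Omega>"
      using f that by (auto simp: test_functions_in_def test_functions_def)
  qed
  moreover have "open_test_functions_in K (test_functions_in K :: (real ^ 'd \<Rightarrow> 'k ^ 'n) set)"
    for K
    by (auto simp: open_test_functions_in_def intro: exI[of _ 1])
  moreover have "(test_functions \<Omega> :: (real ^ 'd \<Rightarrow> 'k ^ 'n) set) \<noteq> {}"
    using zero_in_test_functions by blast
  ultimately show ?thesis
    by (auto simp: test_nbhds_def absolutely_convex_def Int_absorb1 intro: test_functions_lincomb)
qed

lemma openin_test_topology:
  fixes U :: "(real ^ 'd \<Rightarrow> 'k::real_or_complex ^ 'n) set"
  shows "openin (test_topology \<Omega>) U \<longleftrightarrow> U \<subseteq> test_functions \<Omega> \<and>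
     (\<forall>f \<in> U. \<exists>W \<in> test_nbhds \<Omega>. (\<lambda>w. f + w) ` W \<subseteq> U)"
proof -
  have "istopology (\<lambda>U :: (real ^ 'd \<Rightarrow> 'k ^ 'n) set. U \<subseteq> test_functions \<Omega> \<and>
      (\<forall>f \<in> U. \<exists>W \<in> test_nbhds \<Omega>. (\<lambda>w. f + w) ` W \<subseteq> U))"
    unfolding istopology_def
  proof (rule conjI; intro allI impI)
    fix S T :: "(real ^ 'd \<Rightarrow> 'k ^ 'n) set"
    assume S: "S \<subseteq> test_functions \<Omega> \<and> (\<forall>f \<in> S. \<exists>W \<in> test_nbhds \<Omega>. (\<lambda>w. f + w) ` W \<subseteq> S)"
      and T: "T \<subseteq> test_functions \<Omega> \<and> (\<forall>f \<in> T. \<exists>W \<in> test_nbhds \<Omega>. (\<lambda>w. f + w) ` W \<subseteq> T)"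
    have "\<exists>W \<in> test_nbhds \<Omega>. (\<lambda>w. f + w) ` W \<subseteq> S \<inter> T" if f: "f \<in> S \<inter> T" for f
    proof -
      obtain V W where "V \<in> test_nbhds \<Omega>" "(\<lambda>w. f + w) ` V \<subseteq> S"
        "W \<in> test_nbhds \<Omega>" "(\<lambda>w. f + w) ` W \<subseteq> T"
        using S T f by blast
      then show ?thesis by (intro bexI[of _ "V \<inter> W"]) (auto intro: test_nbhds_Int)
    qed
    then show "S \<inter> T \<subseteq> test_functions \<Omega> \<and>
        (\<forall>f \<in> S \<inter> T. \<exists>W \<in> test_nbhds \<Omega>. (\<lambda>w. f + w) ` W \<subseteq> S \<inter> T)"
      using S by blast
  next
    fix \<K> :: "(real ^ 'd \<Rightarrow> 'k ^ 'n) set set"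
    assume "\<forall>S \<in> \<K>. S \<subseteq> test_functions \<Omega> \<and>
      (\<forall>f \<in> S. \<exists>W \<in> test_nbhds \<Omega>. (\<lambda>w. f + w) ` W \<subseteq> S)"
    then show "\<Union>\<K> \<subseteq> test_functions \<Omega> \<and>
      (\<forall>f \<in> \<Union>\<K>. \<exists>W \<in> test_nbhds \<Omega>. (\<lambda>w. f + w) ` W \<subseteq> \<Union>\<K>)"
      by (meson Sup_least Union_iff Union_upper subset_trans)
  qed
  then show ?thesis by (simp add: test_topology_def topology_inverse')
qed

lemma topspace_test_topology: "topspace (test_topology \<Omega>) = test_functions \<Omega>"
proof (rule antisym)
  show "topspace (test_topology \<Omega>) \<subseteq> test_functions \<Omega>"
    using openin_test_topology openin_topspace by blast
  have "(\<lambda>w. f + w) ` test_functions \<Omega> \<subseteq> test_functions \<Omega>" if "f \<in> test_functions \<Omega>" for f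
    using that test_functions_add by auto
  then have "openin (test_topology \<Omega>) (test_functions \<Omega>)"
    using test_functions_in_test_nbhds by (auto simp: openin_test_topology)
  then show "test_functions \<Omega> \<subseteq> topspace (test_topology \<Omega>)" by (rule openin_subset)
qed

end

theory Submission
  imports Defs
begin

text \<open>
  All three statements say that \<open>A x = A y\<close> implies \<open>A (P g x) = A (P g y)\<close>, for every \<open>g\<close>.
  By linearity this means that the kernel of \<open>A\<close> is contained in that of \<open>A \<circ> P g\<close>; the
  reverse inclusion is the same inclusion for \<open>inv g\<close>, applied to \<open>P g x\<close>. The induced maps
  inherit linearity and the homomorphism law from \<open>P\<close>, and are inverted by those of \<open>inv g\<close>.
\<close>

lemma carrier_GL: "L \<in> carrier (GL V) \<longleftrightarrow> L \<in> Bij V \<and> linear_op_on V L"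
  by (simp add: GL_def)

text \<open>The product of \<open>BijGroup\<close> is itself a function restricted to
  \<open>Bij V\<close>, so it unfolds to \<open>compose\<close> for factors known to lie
  there.\<close>

lemma mult_GL:
  assumes "L \<in> carrier (GL V)" "M \<in> carrier (GL V)"
  shows "L \<otimes>\<^bsub>GL V\<^esub> M = compose V L M"
  using assms by (simp add: GL_def BijGroup_def)

lemma one_GL: "\<one>\<^bsub>GL V\<^esub> = (\<lambda>x\<in>V. x)"
  by (simp add: GL_def BijGroup_def)

text \<open>Additivity is given on \<open>V\<close> alone; it is applied to
  \<open>(f - g) + g\<close>, where \<open>f - g\<close> stays in the subspace.\<close>

lemma linear_op_on_diff:
  fixes V :: "('a \<Rightarrow> 'k::field ^ 'n) set"
  assumes "module.subspace fun_scale V" "linear_op_on V L" "f \<in> V" "g \<in> V"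
  shows "L (f - g) = L f - L g"
proof -
  interpret vector_space "fun_scale :: 'k \<Rightarrow> ('a \<Rightarrow> 'k ^ 'n) \<Rightarrow> _"
    by (rule vector_space_fun_scale)
  have "f - g \<in> V" using assms by (simp add: subspace_diff)
  then have "L (f - g + g) = L (f - g) + L g" using assms by (simp only: linear_op_on_def)
  then show ?thesis by simp
qed

text \<open>The algebraic setting, over any field; the theorem is the instance in which
  \<open>V\<close> is the space of test functions.\<close>

locale represented_operator = group G for G (structure) +
  fixes V :: "('a \<Rightarrow> 'k::field ^ 'n) set"
    and P :: "'g \<Rightarrow> ('a \<Rightarrow> 'k ^ 'n) \<Rightarrow> ('a \<Rightarrow> 'k ^ 'n)"
    and A :: "('a \<Rightarrow> 'k ^ 'n) \<Rightarrow> ('b \<Rightarrow> 'k ^ 'm)"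
  assumes subspace_V: "module.subspace fun_scale V"
    and rep: "representation G V P"
    and linear_A: "linear_op_on V A"
begin

sublocale fs: vector_space "fun_scale :: 'k \<Rightarrow> ('a \<Rightarrow> 'k ^ 'n) \<Rightarrow> _"
  by (rule vector_space_fun_scale)

text \<open>This says that \<open>A \<circ> P g\<close> factors through \<open>A\<close>. It is the
  hub: each of the three statements is compared with it separately.\<close>

definition well_defined :: bool where
  "well_defined \<longleftrightarrow>
     (\<forall>g \<in> carrier G. \<forall>x \<in> V. \<forall>y \<in> V. A x = A y \<longrightarrow> A (P g x) = A (P g y))"

lemma P_in_GL: "g \<in> carrier G \<Longrightarrow> P g \<in> carrier (GL V)"
  using rep by (auto simp: representation_def hom_def)

lemma P_closed: "g \<in> carrier G \<Longrightarrow> x \<in> V \<Longrightarrow> P g x \<in> V"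
  using P_in_GL Bij_imp_funcset by (fastforce simp: carrier_GL)

lemma P_linear: "g \<in> carrier G \<Longrightarrow> linear_op_on V (P g)"
  using P_in_GL by (simp add: carrier_GL)

lemma P_mult:
  assumes "g \<in> carrier G" "h \<in> carrier G" "x \<in> V"
  shows "P (g \<otimes> h) x = P g (P h x)"
  using rep assms by (simp add: representation_def hom_mult mult_GL P_in_GL compose_eq)

text \<open>A representation is only required to be multiplicative. It preserves the unit because
  \<open>GL V\<close> is a group, \<open>V\<close> being a subspace.\<close>

lemma P_one: "x \<in> V \<Longrightarrow> P \<one> x = x"
  using hom_one[OF rep[unfolded representation_def] is_group group_GL[OF subspace_V]]
  by (simp add: one_GL)

lemma P_inv: "g \<in> carrier G \<Longrightarrow> x \<in> V \<Longrightarrow> P (inv g) (P g x) = x"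
  by (metis P_mult P_one inv_closed l_inv)

lemma A_add: "x \<in> V \<Longrightarrow> y \<in> V \<Longrightarrow> A (x + y) = A x + A y"
  and A_scale: "x \<in> V \<Longrightarrow> A (fun_scale c x) = fun_scale c (A x)"
  using linear_A by (simp_all add: linear_op_on_def)

lemma P_add: "g \<in> carrier G \<Longrightarrow> x \<in> V \<Longrightarrow> y \<in> V \<Longrightarrow> P g (x + y) = P g x + P g y"
  and P_scale: "g \<in> carrier G \<Longrightarrow> x \<in> V \<Longrightarrow> P g (fun_scale c x) = fun_scale c (P g x)"
  using P_linear by (simp_all add: linear_op_on_def)

text \<open>A map on the range with the prescribed values exists exactly when these values agree on
  the fibres of \<open>A\<close>. Uniqueness is then automatic, since extensionality fixes the map
  outside the range.\<close>

lemma well_defined_iff_induced_maps: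
  "well_defined \<longleftrightarrow>
     (\<forall>g \<in> carrier G. \<exists>!Q. Q \<in> A ` V \<rightarrow>\<^sub>E A ` V \<and> (\<forall>x \<in> V. Q (A x) = A (P g x)))"
proof
  assume wd: well_defined
  show "\<forall>g \<in> carrier G. \<exists>!Q. Q \<in> A ` V \<rightarrow>\<^sub>E A ` V \<and> (\<forall>x \<in> V. Q (A x) = A (P g x))"
  proof
    fix g assume g: "g \<in> carrier G"
    show "\<exists>!Q. Q \<in> A ` V \<rightarrow>\<^sub>E A ` V \<and> (\<forall>x \<in> V. Q (A x) = A (P g x))"
    proof (rule ex_ex1I)
      \<comment> \<open>An arbitrary preimage of \<open>y\<close> is chosen;
        \<open>well_defined\<close> compares it with any other preimage \<open>x\<close>.\<close>
      let ?Q = "\<lambda>y \<in> A ` V. A (P g (inv_into V A y))"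
      have "?Q (A x) = A (P g x)" if "x \<in> V" for x
        using wd[unfolded well_defined_def, rule_format,
            OF g inv_into_into[of "A x" A V] that f_inv_into_f[of "A x" A V]] that
        by simp
      moreover from this have "?Q \<in> A ` V \<rightarrow>\<^sub>E A ` V"
        using P_closed[OF g] by (auto simp: PiE_iff inv_into_into)
      ultimately show "\<exists>Q. Q \<in> A ` V \<rightarrow>\<^sub>E A ` V \<and> (\<forall>x \<in> V. Q (A x) = A (P g x))"
        by blast
    next
      fix Q Q' assume QQ': "Q \<in> A ` V \<rightarrow>\<^sub>E A ` V \<and> (\<forall>x \<in> V. Q (A x) = A (P g x))"
        "Q' \<in> A ` V \<rightarrow>\<^sub>E A ` V \<and> (\<forall>x \<in> V. Q' (A x) = A (P g x))"
      show "Q = Q'"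
        by (rule extensionalityI[where A = "A ` V"]) (use QQ' in \<open>auto simp: PiE_iff\<close>)
    qed
  qed
next
  assume Q: "\<forall>g \<in> carrier G. \<exists>!Q. Q \<in> A ` V \<rightarrow>\<^sub>E A ` V \<and> (\<forall>x \<in> V. Q (A x) = A (P g x))"
  have "A (P g x) = A (P g y)"
    if g: "g \<in> carrier G" and xy: "x \<in> V" "y \<in> V" "A x = A y" for g x y
  proof -
    obtain Q where "\<forall>x \<in> V. Q (A x) = A (P g x)" using Q g by blast
    then show ?thesis using xy by metis
  qed
  then show well_defined unfolding well_defined_def by blast
qed

lemma well_defined_iff_ker_eq:
  "well_defined \<longleftrightarrow> (\<forall>g \<in> carrier G. ker_on V (A \<circ> P g) = ker_on V A)"
proof
  assume wd: well_defined
  have ker: "A (P g x) = 0" if "g \<in> carrier G" "x \<in> V" "A x = 0" for g x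
  proof -
    \<comment> \<open>Well-definedness will be applied to the pair \<open>x\<close>,
      \<open>0\<close>. Here \<open>0\<close> is written as \<open>x - x\<close>.\<close>
    have "A 0 = 0"
      using linear_op_on_diff[OF subspace_V linear_A that(2) that(2)] by simp
    then have "A (P g x) = A (P g 0)"
      using wd that fs.subspace_0[OF subspace_V] unfolding well_defined_def by metis
    also have "P g 0 = 0"
      using linear_op_on_diff[OF subspace_V P_linear[OF that(1)] that(2) that(2)] by simp
    also have "A 0 = 0" by fact
    finally show ?thesis .
  qed
  moreover have "A x = 0" if "g \<in> carrier G" "x \<in> V" "A (P g x) = 0" for g x
    using ker[of "inv g" "P g x"] that by (simp add: P_closed P_inv)
  ultimately show "\<forall>g \<in> carrier G. ker_on V (A \<circ> P g) = ker_on V A"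
    unfolding ker_on_def comp_apply by blast
next
  assume ker: "\<forall>g \<in> carrier G. ker_on V (A \<circ> P g) = ker_on V A"
  have "A (P g x) = A (P g y)"
    if g: "g \<in> carrier G" and xy: "x \<in> V" "y \<in> V" "A x = A y" for g x y
  proof -
    \<comment> \<open>Equality of two values of \<open>A\<close> becomes membership of the
      difference in the kernel, which the hypothesis carries over to
      \<open>A \<circ> P g\<close>.\<close>
    have "x - y \<in> ker_on V A"
      using xy by (simp add: ker_on_def linear_op_on_diff[OF subspace_V linear_A]
          fs.subspace_diff[OF subspace_V])
    then have "A (P g (x - y)) = 0" using ker g by (auto simp: ker_on_def)
    then show ?thesis
      using g xy by (simp add: linear_op_on_diff[OF subspace_V P_linear]
          linear_op_on_diff[OF subspace_V linear_A] P_closed)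
  qed
  then show well_defined unfolding well_defined_def by blast
qed

text \<open>Every point of the range has the form \<open>A x\<close>, and there \<open>QA\<close>
  turns each required identity for \<open>Q\<close> into the image under \<open>A\<close> of the
  same identity for \<open>P\<close>.\<close>

lemma induced_representation:
  assumes Q: "\<And>g. g \<in> carrier G \<Longrightarrow> Q g \<in> A ` V \<rightarrow>\<^sub>E A ` V"
    and QA: "\<And>g x. g \<in> carrier G \<Longrightarrow> x \<in> V \<Longrightarrow> Q g (A x) = A (P g x)"
  shows "representation G (A ` V) Q"
proof -
  have GL: "Q g \<in> carrier (GL (A ` V))" if g: "g \<in> carrier G" for g
  proof -
    have "bij_betw (Q g) (A ` V) (A ` V)"
    proof (rule bij_betwI[where g = "Q (inv g)"])
      show "Q (inv g) (Q g y) = y" if "y \<in> A ` V" for y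
        using that g by (auto simp: QA P_closed P_inv)
      show "Q g (Q (inv g) y) = y" if "y \<in> A ` V" for y
        using that g P_inv[of "inv g"] by (auto simp: QA P_closed)
    qed (use Q[OF g] Q[OF inv_closed[OF g]] in auto)
    moreover have "Q g \<in> extensional (A ` V)" using Q[OF g] by (simp add: PiE_iff)
    \<comment> \<open>Reading \<open>A_add\<close> backwards gathers the argument into
      \<open>A (x + y)\<close>, to which \<open>QA\<close> applies; both sides become
      \<open>A (P g x + P g y)\<close>.\<close>
    moreover have "Q g (A x + A y) = Q g (A x) + Q g (A y)" if "x \<in> V" "y \<in> V" for x y
      using that g by (simp add: QA P_closed P_add fs.subspace_add[OF subspace_V] flip: A_add)
    moreover have "Q g (fun_scale c (A x)) = fun_scale c (Q g (A x))" if "x \<in> V" for c x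
      using that g by (simp add: QA P_closed P_scale fs.subspace_scale[OF subspace_V] flip: A_scale)
    ultimately show ?thesis by (auto simp: carrier_GL Bij_def linear_op_on_def)
  qed
  moreover have "Q (g \<otimes> h) = Q g \<otimes>\<^bsub>GL (A ` V)\<^esub> Q h"
    if gh: "g \<in> carrier G" "h \<in> carrier G" for g h
  proof -
    \<comment> \<open>Both sides are extensional on the range, so they need only be compared at
      points \<open>A x\<close>.\<close>
    have "Q (g \<otimes> h) = compose (A ` V) (Q g) (Q h)"
    proof (rule extensionalityI[where A = "A ` V"])
      show "Q (g \<otimes> h) \<in> extensional (A ` V)" using Q gh by (simp add: PiE_iff)
    qed (use gh in \<open>auto simp: compose_eq QA P_closed P_mult\<close>)
    then show ?thesis using GL gh by (simp add: mult_GL)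
  qed
  ultimately show ?thesis by (auto simp: representation_def hom_def)
qed

text \<open>Uniqueness rests on extensionality at two levels: in the group element, by the explicit
  condition on \<open>Q\<close>, and in the vector, because members of \<open>GL\<close> are
  extensional. For the converse, the relation for any such \<open>Q\<close> already forces equal
  values on the fibres of \<open>A\<close>.\<close>

lemma well_defined_iff_induced_representation:
  "well_defined \<longleftrightarrow>
     (\<exists>!Q. Q \<in> extensional (carrier G) \<and> representation G (A ` V) Q \<and>
        (\<forall>g \<in> carrier G. \<forall>x \<in> V. Q g (A x) = A (P g x)))"
proof
  assume well_defined
  then have "\<forall>g \<in> carrier G. \<exists>Q. Q \<in> A ` V \<rightarrow>\<^sub>E A ` V \<and> (\<forall>x \<in> V. Q (A x) = A (P g x))"
    unfolding well_defined_iff_induced_maps by blast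
  then obtain Q where Q: "\<And>g. g \<in> carrier G \<Longrightarrow> Q g \<in> A ` V \<rightarrow>\<^sub>E A ` V"
      "\<And>g x. g \<in> carrier G \<Longrightarrow> x \<in> V \<Longrightarrow> Q g (A x) = A (P g x)"
    by metis
  show "\<exists>!Q. Q \<in> extensional (carrier G) \<and> representation G (A ` V) Q \<and>
      (\<forall>g \<in> carrier G. \<forall>x \<in> V. Q g (A x) = A (P g x))"
  proof (rule ex_ex1I)
    \<comment> \<open>The chosen family is arbitrary outside the group; restricting it makes it
      extensional and keeps its values on the group.\<close>
    have "representation G (A ` V) (restrict Q (carrier G))"
      by (rule induced_representation) (simp_all add: Q)
    then show "\<exists>Q. Q \<in> extensional (carrier G) \<and> representation G (A ` V) Q \<and>
        (\<forall>g \<in> carrier G. \<forall>x \<in> V. Q g (A x) = A (P g x))"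
      using Q(2) by (intro exI[of _ "restrict Q (carrier G)"]) simp
  next
    fix R R'
    assume R: "R \<in> extensional (carrier G) \<and> representation G (A ` V) R \<and>
        (\<forall>g \<in> carrier G. \<forall>x \<in> V. R g (A x) = A (P g x))"
      and R': "R' \<in> extensional (carrier G) \<and> representation G (A ` V) R' \<and>
        (\<forall>g \<in> carrier G. \<forall>x \<in> V. R' g (A x) = A (P g x))"
    have "R g = R' g" if g: "g \<in> carrier G" for g
    proof (rule extensionalityI[where A = "A ` V"])
      have "R g \<in> carrier (GL (A ` V))" "R' g \<in> carrier (GL (A ` V))"
        using R R' g by (auto simp: representation_def hom_def)
      then show "R g \<in> extensional (A ` V)" "R' g \<in> extensional (A ` V)"
        by (simp_all add: carrier_GL Bij_def)
    qed (use R R' g in auto)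
    then show "R = R'" using R R' by (auto intro: extensionalityI)
  qed
next
  assume "\<exists>!Q. Q \<in> extensional (carrier G) \<and> representation G (A ` V) Q \<and>
      (\<forall>g \<in> carrier G. \<forall>x \<in> V. Q g (A x) = A (P g x))"
  then obtain Q where "\<forall>g \<in> carrier G. \<forall>x \<in> V. Q g (A x) = A (P g x)" by blast
  then show well_defined unfolding well_defined_def by metis
qed

end

theorem theorem3p1:
  fixes G :: "('g, 'r) monoid_scheme"
    and T :: "'g topology"
    and E :: "'e::euclidean_space set"
    and \<A> :: "('g set \<times> ('g \<Rightarrow> 'e)) set"
    and \<Omega>\<^sub>X :: "(real ^ 'dx) set"
    and \<Omega>\<^sub>Y :: "(real ^ 'dy) set"
    and X :: "(real ^ 'dx \<Rightarrow> 'k::real_or_complex ^ 'nx) set"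
    and Y :: "(real ^ 'dy \<Rightarrow> 'k ^ 'ny) set"
    and P\<^sub>X :: "'g \<Rightarrow> (real ^ 'dx \<Rightarrow> 'k ^ 'nx) \<Rightarrow> (real ^ 'dx \<Rightarrow> 'k ^ 'nx)"
    and A :: "(real ^ 'dx \<Rightarrow> 'k ^ 'nx) \<Rightarrow> (real ^ 'dy \<Rightarrow> 'k ^ 'ny)"
  defines "X \<equiv> test_functions \<Omega>\<^sub>X"
    and "Y \<equiv> test_functions \<Omega>\<^sub>Y"
  assumes "open \<Omega>\<^sub>X" "connected \<Omega>\<^sub>X" "\<Omega>\<^sub>X \<noteq> {}"
    and "open \<Omega>\<^sub>Y" "connected \<Omega>\<^sub>Y" "\<Omega>\<^sub>Y \<noteq> {}"
    and "lie_group G T E \<A>"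
    and "representation G X P\<^sub>X"
    and "A \<in> X \<rightarrow> Y" "linear_op_on X A"
    and "continuous_map (test_topology \<Omega>\<^sub>X) (test_topology \<Omega>\<^sub>Y) A"
  defines "i \<equiv> (\<forall>g \<in> carrier G. \<exists>!Q. Q \<in> A ` X \<rightarrow>\<^sub>E A ` X \<and> (\<forall>x \<in> X. Q (A x) = A (P\<^sub>X g x)))"
    and "ii \<equiv> (\<exists>!P\<^sub>Y. P\<^sub>Y \<in> extensional (carrier G) \<and> representation G (A ` X) P\<^sub>Y \<and>
           (\<forall>g \<in> carrier G. \<forall>x \<in> X. P\<^sub>Y g (A x) = A (P\<^sub>X g x)))"
    and "iii \<equiv> (\<forall>g \<in> carrier G. ker_on X (A \<circ> P\<^sub>X g) = ker_on X A)"
  shows "(i \<longleftrightarrow> ii) \<and> (ii \<longleftrightarrow> iii)"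
proof -
  interpret lie_group G T E \<A> by fact
  interpret represented_operator G X P\<^sub>X A
  proof
    show "module.subspace fun_scale X" unfolding X_def by (rule subspace_test_functions)
  qed fact+
  show ?thesis
    \<comment> \<open>All three statements fold to \<open>well_defined\<close>, and the equivalences
      become trivial.\<close>
    by (simp only: i_def ii_def iii_def flip: well_defined_iff_induced_maps
        well_defined_iff_induced_representation well_defined_iff_ker_eq)
qed

end
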